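(* Every finitely generated bounded automata group is a special co-ET0L group.
   Context: **Bounded automata groups.** Let $\Sigma$ be a finite set with $d\ge 2$ elements. Identify $\Sigma^*$ with the vertex set of the $d$-regular rooted tree $\mathcal T_\Sigma$ (the root is the empty string; the $d$ edges down from each vertex are labelled by the elements of $\Sigma$), and let $\mathcal A_\Sigma$ be the group of all permutations of $\Sigma^*$ that induce automorphisms of $\mathcal T_\Sigma$. Thus $\alpha\in\mathcal A_\Sigma$ preserves length and prefixes, and for $\mathbf x\in\Sigma^*$ the restriction $\alpha|_{\mathbf x}$ is defined by $(\mathbf x\mathbf y)^\alpha=\mathbf x^\alpha\,\mathbf y^{\alpha|_{\mathbf x}}$ for all strings $\mathbf y$. An element $\alpha\in\mathcal A_\Sigma$ is an automaton automorphism if there is a finite-state transducer (reading and outputting one letter of $\Sigma$ at a time) which outputs $\mathbf x^\alpha$ on input $\mathbf x$, for every $\mathbf x\in\Sigma^*$. It is bounded if there is $N\in\mathbb N$ such that for every $k\in\mathbb N$ at most $N$ strings $\mathbf x\in\Sigma^k$ satisfy $\alpha|_{\mathbf x}\ne 1$. The bounded automaton automorphisms form a subgroup $\mathcal D_\Sigma$ of $\mathcal A_\Sigma$. A bounded automata group is a subgroup of $\mathcal D_\Sigma$ for some finite set $\Sigma$ (with at least two elements). **Check stack pushdown automata (cspda).** A cspda $M$ over a finite input alphabet $A$ is a non-deterministic finite-state automaton (with a finite set of states, a single initial state, and a subset of accepting states) with a one-way input tape, a check stack with finite alphabet $\Delta$ and a pushdown stack with finite alphabet $\Gamma$. A computation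 has two stages. - First stage (initialisation): starting from the initial state, $M$ non-deterministically pushes symbols onto the check stack under the control of its finite-state control. It does not read input and does not use the pushdown stack. (So the possible check stack contents form a regular language.) - Second stage: the check stack is never altered. $M$ may read letters from the input tape and push symbols onto, or pop symbols from, the pushdown stack. The read-write head is always at the top of the pushdown stack and at the corresponding height on the check stack (it moves up by one on both when a symbol is pushed and down by one when a symbol is popped). Each transition depends on the current state, the top pushdown symbol, the check stack symbol at the same height, and, if it is a reading transition, the next input letter, which is consumed. It changes the state and may push or pop. $M$ accepts $w\in A^*$ if some computation enters an accepting state at some stage after reading all of $w$; $L(M)$ is the set of accepted words. A configuration consists of the state and the contents of the two stacks. **Special cspda.** $M$ is special if (P1)–(P7) hold. - (P1) Each state is either reading (all its out-transitions read an input letter) or non-reading (none of its out-transitions reads an input letter). - (P2) The operation of $M$ throughout the second stage is deterministic. - (P3) $\Delta$ and $\Gamma$ both contain a bottom-of-stack symbol $\mathfrak b$ and a padding symbol $\mathsf p$, and $\Delta$ contains a top-of-stack symbol $\mathfrak t$. After initialisation the check stack has $\mathfrak b$ at the bottom and $\mathfrak t$ at the top. The first transition of the second stage writes $\mathfrak b$ at the bottom of the pushdown stack, after which $M$ moves into a reading state. The symbol $\mathfrak b$ occurs only at the bottoms of the two stacks, $\mathfrak t$ occurs only at the top of the check stack, $\mathfrak b$ is never popped, and when $\mathfrak t$ is seen on the check stack no symbol can be pushed (so the head never moves above the top of the check stack). - (P4) No computation contains an infinitely long sequence of non-reading transitions in the second stage. - (P5) All accepting states are reading states. - (P6) For every entry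 configuration $C$ and all $u,v\in A^*$ with $v\notin L(M)$, either $C^{uv}=C^u$ or $C^{uv}$ fails. - (P7) The accepting states are exactly the reading states that are not entry states. Terminology used here: a configuration is reading (accepting) if its state is reading (accepting). An entry configuration is one arising immediately after the first transition of the second stage (the one writing $\mathfrak b$ on the pushdown stack), and its state is an entry state. A failing configuration is a non-accepting reading configuration from which no accepting configuration can be reached. For a reading configuration $C$ and $w\in A^*$, $C^w$ is the configuration of $M$, run in the second stage from $C$ on input $w$, as it enters its first reading state after reading all of $w$ (so $C^{\epsilon}=C$ for the empty word $\epsilon$). $C^w$ fails if a failing configuration is entered in this process, or if the machine gets stuck before reaching such a reading state. **Special co-ET0L groups.** A language accepted by a special cspda is a special ET0L language. For a group $G$ with finite inverse-closed generating set $A$, $\mathsf{coWP}(G,A)=\{w\in A^*: w\neq_G 1\}$. A finitely generated group $G$ is a special co-ET0L group if, for some finite inverse-closed generating set $A$ of $G$, some special cspda with input alphabet $A$ (and, by convention, $A\subseteq\Delta$, $A\subseteq\Gamma$) accepts $\mathsf{coWP}(G,A)$. *)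

theory Defs
  imports "HOL-Algebra.Generated_Groups" "HOL-Library.Sublist"
begin

section \<open>Bounded automata groups\<close>

text \<open>The alphabet is a finite type \<open>'s\<close>; the vertices of the rooted tree are the words over it.\<close>

definition tree_edge :: "'s list \<Rightarrow> 's list \<Rightarrow> bool" where
  "tree_edge x y \<longleftrightarrow> (\<exists>a. y = x @ [a])"

definition tree_automorphism :: "('s list \<Rightarrow> 's list) \<Rightarrow> bool" where
  "tree_automorphism \<alpha> \<longleftrightarrow>
     bij \<alpha> \<and> \<alpha> [] = [] \<and> (\<forall>x y. tree_edge (\<alpha> x) (\<alpha> y) \<longleftrightarrow> tree_edge x y)"

definition restriction :: "('s list \<Rightarrow> 's list) \<Rightarrow> 's list \<Rightarrow> 's list \<Rightarrow> 's list" where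
  "restriction \<alpha> x = (\<lambda>y. drop (length x) (\<alpha> (x @ y)))"

fun transduce :: "('q \<Rightarrow> 's \<Rightarrow> 'q) \<Rightarrow> ('q \<Rightarrow> 's \<Rightarrow> 's) \<Rightarrow> 'q \<Rightarrow> 's list \<Rightarrow> 's list" where
  "transduce nxt out q [] = []"
| "transduce nxt out q (a # x) = out q a # transduce nxt out (nxt q a) x"

text \<open>Taking the states to be natural numbers is no restriction, as there are finitely many.\<close>

definition automaton_automorphism :: "('s list \<Rightarrow> 's list) \<Rightarrow> bool" where
  "automaton_automorphism \<alpha> \<longleftrightarrow> tree_automorphism \<alpha> \<and>
     (\<exists>(Q :: nat set) q0 nxt out. finite Q \<and> q0 \<in> Q \<and> (\<forall>q\<in>Q. \<forall>a. nxt q a \<in> Q) \<and>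
        (\<forall>x. \<alpha> x = transduce nxt out q0 x))"

definition bounded_automorphism :: "('s::finite list \<Rightarrow> 's list) \<Rightarrow> bool" where
  "bounded_automorphism \<alpha> \<longleftrightarrow>
     (\<exists>N. \<forall>k. card {x. length x = k \<and> restriction \<alpha> x \<noteq> id} \<le> N)"

text \<open>Automorphisms act on the right, so the product \<open>\<alpha> \<otimes> \<beta>\<close> applies \<open>\<alpha>\<close> first.\<close>

definition bounded_automaton_aut_group :: "('s::finite list \<Rightarrow> 's list) monoid" where
  "bounded_automaton_aut_group =
     \<lparr> carrier = {\<alpha>. automaton_automorphism \<alpha> \<and> bounded_automorphism \<alpha>},
       mult = (\<lambda>\<alpha> \<beta>. \<beta> \<circ> \<alpha>),
       one = id \<rparr>"

definition bounded_automata_group :: "('s::finite list \<Rightarrow> 's list) monoid \<Rightarrow> bool" where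
  "bounded_automata_group G \<longleftrightarrow> card (UNIV :: 's set) \<ge> 2 \<and>
     (\<exists>H. subgroup H bounded_automaton_aut_group \<and>
          G = bounded_automaton_aut_group \<lparr> carrier := H \<rparr>)"


section \<open>Check stack pushdown automata\<close>

text \<open>
  Stack symbols over an input alphabet of type \<open>'a\<close>. Input letters \<open>a\<close> occur on the stacks as
  \<open>Letter a\<close>. The constructor \<open>Other\<close> supplies arbitrarily many further symbols; a machine uses
  only a finite subset of this type.
\<close>

datatype 'a stack_symbol = Bottom | Padding | Top | Letter 'a | Other nat

datatype 'a stack_op = Push "'a stack_symbol" | Pop | Stay

text \<open>
  A first-stage transition \<open>(q, s, q')\<close> pushes \<open>s\<close> onto the check stack. A second-stage
  transition \<open>(q, x, g, d, oper, q')\<close> reads the letter \<open>a\<close> if \<open>x = Some a\<close> and reads nothing if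
  \<open>x = None\<close>; \<open>g\<close> and \<open>d\<close> are the top pushdown symbol and the check stack symbol at the same
  height, both \<open>None\<close> when the pushdown stack is empty.
\<close>

record ('q, 'a) cspda =
  states :: "'q set"
  start :: 'q
  accepting :: "'q set"
  check_alphabet :: "'a stack_symbol set"
  pushdown_alphabet :: "'a stack_symbol set"
  stage1_trans :: "('q \<times> 'a stack_symbol \<times> 'q) set"
  stage2_trans :: "('q \<times> 'a option \<times> 'a stack_symbol option \<times> 'a stack_symbol option \<times>
                    'a stack_op \<times> 'q) set"

definition cspda_over :: "'a set \<Rightarrow> ('q, 'a) cspda \<Rightarrow> bool" where
  "cspda_over A M \<longleftrightarrow>
     finite A \<and> finite (states M) \<and> start M \<in> states M \<and> accepting M \<subseteq> states M \<and>
     finite (check_alphabet M) \<and> finite (pushdown_alphabet M) \<and>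
     (\<forall>(q, s, q') \<in> stage1_trans M. q \<in> states M \<and> s \<in> check_alphabet M \<and> q' \<in> states M) \<and>
     (\<forall>(q, x, g, d, oper, q') \<in> stage2_trans M.
        q \<in> states M \<and> q' \<in> states M \<and> set_option x \<subseteq> A \<and>
        set_option g \<subseteq> pushdown_alphabet M \<and> set_option d \<subseteq> check_alphabet M \<and>
        (\<forall>s. oper = Push s \<longrightarrow> s \<in> pushdown_alphabet M))"

text \<open>
  Second-stage configurations: state, check stack (bottom symbol first), pushdown stack
  (top symbol first).
\<close>

type_synonym ('q, 'a) config = "'q \<times> 'a stack_symbol list \<times> 'a stack_symbol list"

text \<open>\<open>stage1 M q c\<close>: the first stage can arrive in state \<open>q\<close> with check stack \<open>c\<close>.\<close>

inductive stage1 :: "('q, 'a) cspda \<Rightarrow> 'q \<Rightarrow> 'a stack_symbol list \<Rightarrow> bool" for M where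
  stage1_start: "stage1 M (start M) []"
| stage1_push: "stage1 M q c \<Longrightarrow> (q, s, q') \<in> stage1_trans M \<Longrightarrow> stage1 M q' (c @ [s])"

definition top_symbol :: "'b list \<Rightarrow> 'b option" where
  "top_symbol p = (case p of [] \<Rightarrow> None | g # _ \<Rightarrow> Some g)"

definition symbol_at_height :: "'b list \<Rightarrow> nat \<Rightarrow> 'b option" where
  "symbol_at_height c n = (if 1 \<le> n \<and> n \<le> length c then Some (c ! (n - 1)) else None)"

fun apply_op :: "'a stack_op \<Rightarrow> 'a stack_symbol list \<Rightarrow> 'a stack_symbol list option" where
  "apply_op (Push s) p = Some (s # p)"
| "apply_op Pop (g # p) = Some p"
| "apply_op Pop [] = None"
| "apply_op Stay p = Some p"

definition step :: "('q, 'a) cspda \<Rightarrow> ('q, 'a) config \<Rightarrow> 'a option \<Rightarrow> ('q, 'a) config \<Rightarrow> bool" where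
  "step M C x D \<longleftrightarrow> (\<exists>q q' c p p' oper. C = (q, c, p) \<and> D = (q', c, p') \<and>
     (q, x, top_symbol p, symbol_at_height c (length p), oper, q') \<in> stage2_trans M \<and>
     apply_op oper p = Some p')"

text \<open>\<open>run M C w D\<close>: in the second stage, \<open>M\<close> can get from \<open>C\<close> to \<open>D\<close> while reading exactly \<open>w\<close>.\<close>

inductive run :: "('q, 'a) cspda \<Rightarrow> ('q, 'a) config \<Rightarrow> 'a list \<Rightarrow> ('q, 'a) config \<Rightarrow> bool" for M where
  run_refl: "run M C [] C"
| run_silent: "step M C None C' \<Longrightarrow> run M C' w D \<Longrightarrow> run M C w D"
| run_read: "step M C (Some a) C' \<Longrightarrow> run M C' w D \<Longrightarrow> run M C (a # w) D"

definition accepting_config :: "('q, 'a) cspda \<Rightarrow> ('q, 'a) config \<Rightarrow> bool" where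
  "accepting_config M C \<longleftrightarrow> fst C \<in> accepting M"

definition language :: "'a set \<Rightarrow> ('q, 'a) cspda \<Rightarrow> 'a list set" where
  "language A M = {w \<in> lists A. \<exists>q c C. stage1 M q c \<and> run M (q, c, []) w C \<and> accepting_config M C}"


section \<open>Special check stack pushdown automata\<close>

text \<open>First-stage transitions read no input, so a reading state has none leaving it.\<close>

definition reading_state :: "('q, 'a) cspda \<Rightarrow> 'q \<Rightarrow> bool" where
  "reading_state M q \<longleftrightarrow> q \<in> states M \<and>
     (\<forall>s q'. (q, s, q') \<notin> stage1_trans M) \<and>
     (\<forall>x g d oper q'. (q, x, g, d, oper, q') \<in> stage2_trans M \<longrightarrow> x \<noteq> None)"

definition nonreading_state :: "('q, 'a) cspda \<Rightarrow> 'q \<Rightarrow> bool" where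
  "nonreading_state M q \<longleftrightarrow> q \<in> states M \<and>
     (\<forall>x g d oper q'. (q, x, g, d, oper, q') \<in> stage2_trans M \<longrightarrow> x = None)"

definition reading_config :: "('q, 'a) cspda \<Rightarrow> ('q, 'a) config \<Rightarrow> bool" where
  "reading_config M C \<longleftrightarrow> reading_state M (fst C)"

definition entry_config :: "('q, 'a) cspda \<Rightarrow> ('q, 'a) config \<Rightarrow> bool" where
  "entry_config M C \<longleftrightarrow> (\<exists>q c x. stage1 M q c \<and> step M (q, c, []) x C)"

definition entry_state :: "('q, 'a) cspda \<Rightarrow> 'q \<Rightarrow> bool" where
  "entry_state M q \<longleftrightarrow> (\<exists>c p. entry_config M (q, c, p))"

definition failing_config :: "('q, 'a) cspda \<Rightarrow> ('q, 'a) config \<Rightarrow> bool" where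
  "failing_config M C \<longleftrightarrow> reading_config M C \<and> \<not> accepting_config M C \<and>
     (\<forall>w D. run M C w D \<longrightarrow> \<not> accepting_config M D)"

text \<open>
  \<open>result M C w D\<close> expresses \<open>C\<^sup>w = D\<close>. No non-reading transition leaves a reading state, so \<open>D\<close> is
  in the first reading state entered after \<open>w\<close> has been read, and \<open>D = C\<close> if \<open>w = []\<close> and \<open>C\<close> is
  reading.
\<close>

definition result :: "('q, 'a) cspda \<Rightarrow> ('q, 'a) config \<Rightarrow> 'a list \<Rightarrow> ('q, 'a) config \<Rightarrow> bool" where
  "result M C w D \<longleftrightarrow> run M C w D \<and> reading_config M D"

definition gets_stuck :: "('q, 'a) cspda \<Rightarrow> ('q, 'a) config \<Rightarrow> 'a list \<Rightarrow> bool" where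
  "gets_stuck M C w \<longleftrightarrow> (\<exists>u v D. w = u @ v \<and> run M C u D \<and>
     \<not> (v = [] \<and> reading_config M D) \<and>
     (\<forall>E. \<not> step M D None E) \<and>
     (\<forall>a v' E. v = a # v' \<longrightarrow> \<not> step M D (Some a) E))"

definition fails :: "('q, 'a) cspda \<Rightarrow> ('q, 'a) config \<Rightarrow> 'a list \<Rightarrow> bool" where
  "fails M C w \<longleftrightarrow>
     (\<exists>u D. prefix u w \<and> run M C u D \<and> failing_config M D) \<or> gets_stuck M C w"

definition P1 :: "('q, 'a) cspda \<Rightarrow> bool" where
  "P1 M \<longleftrightarrow> (\<forall>q\<in>states M. reading_state M q \<or> nonreading_state M q)"

text \<open>
  A choice between reading and not reading in the same situation is already excluded by \<open>P1\<close>.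
\<close>

definition P2 :: "('q, 'a) cspda \<Rightarrow> bool" where
  "P2 M \<longleftrightarrow> (\<forall>q x g d oper1 q1 oper2 q2.
     (q, x, g, d, oper1, q1) \<in> stage2_trans M \<longrightarrow> (q, x, g, d, oper2, q2) \<in> stage2_trans M \<longrightarrow>
     oper1 = oper2 \<and> q1 = q2)"

text \<open>
  The transitions with top pushdown symbol \<open>None\<close> are those that can start the second stage. The
  one that does reads no input.
\<close>

definition P3 :: "('q, 'a) cspda \<Rightarrow> bool" where
  "P3 M \<longleftrightarrow>
     {Bottom, Padding, Top} \<subseteq> check_alphabet M \<and>
     {Bottom, Padding} \<subseteq> pushdown_alphabet M \<and>
     (\<forall>q c x D. stage1 M q c \<longrightarrow> step M (q, c, []) x D \<longrightarrow>
        (\<exists>c'. c = Bottom # c' @ [Top] \<and> Bottom \<notin> set c' \<and> Top \<notin> set c')) \<and>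
     (\<forall>(q, x, g, d, oper, q') \<in> stage2_trans M.
        (g = None \<longrightarrow> x = None \<and> oper = Push Bottom \<and> reading_state M q') \<and>
        (g \<noteq> None \<longrightarrow> oper \<noteq> Push Bottom) \<and>
        oper \<noteq> Push Top \<and>
        (g = Some Bottom \<longrightarrow> oper \<noteq> Pop) \<and>
        (d = Some Top \<longrightarrow> (\<forall>s. oper \<noteq> Push s)))"

definition P4 :: "('q, 'a) cspda \<Rightarrow> bool" where
  "P4 M \<longleftrightarrow> \<not> (\<exists>q c w f. stage1 M q c \<and> run M (q, c, []) w (f 0) \<and>
     (\<forall>i::nat. step M (f i) None (f (Suc i))))"

definition P5 :: "('q, 'a) cspda \<Rightarrow> bool" where
  "P5 M \<longleftrightarrow> (\<forall>q\<in>accepting M. reading_state M q)"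

definition P6 :: "'a set \<Rightarrow> ('q, 'a) cspda \<Rightarrow> bool" where
  "P6 A M \<longleftrightarrow> (\<forall>C. \<forall>u\<in>lists A. \<forall>v\<in>lists A. entry_config M C \<longrightarrow> v \<notin> language A M \<longrightarrow>
     (\<exists>D. result M C (u @ v) D \<and> result M C u D) \<or> fails M C (u @ v))"

definition P7 :: "('q, 'a) cspda \<Rightarrow> bool" where
  "P7 M \<longleftrightarrow> accepting M = {q \<in> states M. reading_state M q \<and> \<not> entry_state M q}"

definition special_cspda :: "'a set \<Rightarrow> ('q, 'a) cspda \<Rightarrow> bool" where
  "special_cspda A M \<longleftrightarrow>
     cspda_over A M \<and> P1 M \<and> P2 M \<and> P3 M \<and> P4 M \<and> P5 M \<and> P6 A M \<and> P7 M"


section \<open>Special co-ET0L groups\<close>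

definition finitely_generated_group :: "('a, 'b) monoid_scheme \<Rightarrow> bool" where
  "finitely_generated_group G \<longleftrightarrow> group G \<and>
     (\<exists>A. finite A \<and> A \<subseteq> carrier G \<and> generate G A = carrier G)"

definition word_value :: "('a, 'b) monoid_scheme \<Rightarrow> 'a list \<Rightarrow> 'a" where
  "word_value G w = foldr (\<lambda>a b. a \<otimes>\<^bsub>G\<^esub> b) w \<one>\<^bsub>G\<^esub>"

definition coWP :: "('a, 'b) monoid_scheme \<Rightarrow> 'a set \<Rightarrow> 'a list set" where
  "coWP G A = {w \<in> lists A. word_value G w \<noteq> \<one>\<^bsub>G\<^esub>}"

text \<open>Again, taking the finitely many states to be natural numbers is no restriction.\<close>

definition special_co_ET0L_group :: "('a, 'b) monoid_scheme \<Rightarrow> bool" where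
  "special_co_ET0L_group G \<longleftrightarrow> finitely_generated_group G \<and>
     (\<exists>A. finite A \<and> A \<subseteq> carrier G \<and> (\<forall>a\<in>A. inv\<^bsub>G\<^esub> a \<in> A) \<and> generate G A = carrier G \<and>
        (\<exists>M :: (nat, 'a) cspda. special_cspda A M \<and>
           Letter ` A \<subseteq> check_alphabet M \<and> Letter ` A \<subseteq> pushdown_alphabet M \<and>
           language A M = coWP G A))"

end

theory Submission
  imports Defs "HOL-Library.Countable"
begin

text \<open>
  The check stack holds a guessed string \<open>x\<close> and the pushdown stack, first letter on top, the image
  \<open>y\<close> of \<open>x\<close> under the word read so far; the machine accepts once \<open>y \<noteq> x\<close>. To apply a generator, the
  machine pops letters as long as the prefix read has a non-trivial restriction, then pushes the
  images of these letters back. The popped letters are lost, but by boundedness the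
  number of such active prefixes of each length (over all generators) is bounded, so the finite control
  can remember the position of the current prefix in the list of active prefixes of its length. The
  check stack stores at each level the list of restrictions to the active prefixes of that length;
  these lists form the orbit of one map on a finite set, so the possible check stacks are a regular
  language, and each list determines how to pass from a prefix to its parent. When \<open>y = x\<close>
  the pushdown stack is emptied down to its bottom symbol, so that the configuration depends only on \<open>y\<close>
  and \<open>P6\<close> holds without any failing computation.
\<close>

section \<open>Levels of a bounded automaton\<close>

text \<open>A fixed enumeration of the alphabet, so that active prefixes can be referred to by their
  position in a list.\<close>

definition letter_list :: "'s::finite list" where
  "letter_list = (SOME xs. distinct xs \<and> set xs = UNIV)"

lemma letter_list: "distinct (letter_list :: 's::finite list)" "set (letter_list :: 's list) = UNIV"
proof -
  have "\<exists>xs :: 's list. distinct xs \<and> set xs = UNIV"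
    using finite_distinct_list[OF finite_UNIV] by blast
  then have "distinct (letter_list :: 's list) \<and> set (letter_list :: 's list) = UNIV"
    unfolding letter_list_def by (rule someI_ex)
  then show "distinct (letter_list :: 's list)" "set (letter_list :: 's list) = UNIV"
    by auto
qed

lemma length_transduce [simp]: "length (transduce nxt out q x) = length x"
  by (induction x arbitrary: q) auto

definition trivial_state :: "(nat \<Rightarrow> 's \<Rightarrow> nat) \<Rightarrow> (nat \<Rightarrow> 's \<Rightarrow> 's) \<Rightarrow> nat \<Rightarrow> bool" where
  "trivial_state nxt out q \<longleftrightarrow> (\<forall>x. transduce nxt out q x = x)"

text \<open>Hence prefixes of active words are active, and extending only the active prefixes of one
  length reaches all those of the next.\<close>

lemma trivial_state_nxt:
  assumes "trivial_state nxt out q"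
  shows "trivial_state nxt out (nxt q s)"
  unfolding trivial_state_def
proof
  fix x
  have "transduce nxt out q (s # x) = s # x"
    using assms by (simp only: trivial_state_def)
  then show "transduce nxt out (nxt q s) x = x" by simp
qed

text \<open>\<open>S\<close> lists the states reached along the prefixes followed at one length. A
  pair \<open>(j, s)\<close> stands for the \<open>j\<close>-th of them extended by
  \<open>s\<close>; its position in this list is its index one level further down.\<close>

definition active_children ::
    "(nat \<Rightarrow> 's::finite \<Rightarrow> nat) \<Rightarrow> (nat \<Rightarrow> 's \<Rightarrow> 's) \<Rightarrow> nat list \<Rightarrow> (nat \<times> 's) list" where
  "active_children nxt out S =
     filter (\<lambda>(j, s). \<not> trivial_state nxt out (nxt (S ! j) s))
       (List.product [0..<length S] letter_list)"

definition next_level ::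
    "(nat \<Rightarrow> 's::finite \<Rightarrow> nat) \<Rightarrow> (nat \<Rightarrow> 's \<Rightarrow> 's) \<Rightarrow> nat list \<Rightarrow> nat list" where
  "next_level nxt out S = map (\<lambda>(j, s). nxt (S ! j) s) (active_children nxt out S)"

lemma distinct_active_children: "distinct (active_children nxt out S)"
  unfolding active_children_def by (simp add: distinct_product letter_list)

lemma set_active_children:
  "set (active_children nxt out S) =
     (SIGMA j:{..<length S}. {s. \<not> trivial_state nxt out (nxt (S ! j) s)})"
  unfolding active_children_def by (auto simp: letter_list)

lemma length_next_level: "length (next_level nxt out S) = length (active_children nxt out S)"
  unfolding next_level_def by simp

lemma active_childrenE:
  assumes "j < length S" "\<not> trivial_state nxt out (nxt (S ! j) s)"
  obtains k where "k < length (active_children nxt out S)" "active_children nxt out S ! k = (j, s)"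
proof -
  have "(j, s) \<in> set (active_children nxt out S)"
    using assms by (simp add: set_active_children)
  then show thesis using that by (auto simp: in_set_conv_nth)
qed

lemma active_children_nth:
  assumes "k < length (active_children nxt out S)" "active_children nxt out S ! k = (j, s)"
  shows "j < length S" "next_level nxt out S ! k = nxt (S ! j) s"
proof -
  have "(j, s) \<in> set (active_children nxt out S)"
    using assms by (metis nth_mem)
  then show "j < length S" by (simp add: set_active_children)
  show "next_level nxt out S ! k = nxt (S ! j) s"
    using assms by (simp add: next_level_def)
qed

section \<open>Counting active words\<close>

definition active_count ::
    "(nat \<Rightarrow> 's::finite \<Rightarrow> nat) \<Rightarrow> (nat \<Rightarrow> 's \<Rightarrow> 's) \<Rightarrow> nat \<Rightarrow> nat \<Rightarrow> nat" where
  "active_count nxt out n q =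
     card {x. length x = n \<and> \<not> trivial_state nxt out (foldl nxt q x)}"

lemma trivial_state_foldl:
  "trivial_state nxt out q \<Longrightarrow> trivial_state nxt out (foldl nxt q x)"
  by (induction x arbitrary: q) (auto intro: trivial_state_nxt)

lemma active_count_trivial: "trivial_state nxt out q \<Longrightarrow> active_count nxt out n q = 0"
  by (simp add: active_count_def trivial_state_foldl)

lemma active_count_0: "\<not> trivial_state nxt out q \<Longrightarrow> active_count nxt out 0 q = 1"
proof -
  assume "\<not> trivial_state nxt out q"
  then have "{x :: 'a list. length x = 0 \<and> \<not> trivial_state nxt out (foldl nxt q x)} = {[]}" by auto
  then show ?thesis by (simp add: active_count_def)
qed

lemma finite_length_eq: "finite {x :: 's::finite list. length x = n \<and> P x}"
  using finite_lists_length_eq[of "UNIV :: 's set" n] by (auto intro: finite_subset[rotated])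

lemma active_count_Suc:
  "active_count nxt out (Suc n) q = (\<Sum>s\<in>UNIV. active_count nxt out n (nxt q s))"
proof -
  let ?X = "\<lambda>s. {x. length x = n \<and> \<not> trivial_state nxt out (foldl nxt (nxt q s) x)}"
  have "{x. length x = Suc n \<and> \<not> trivial_state nxt out (foldl nxt q x)} = (\<Union>s. (#) s ` ?X s)"
    by (fastforce simp: length_Suc_conv)
  then have "active_count nxt out (Suc n) q = card (\<Union>s. (#) s ` ?X s)"
    by (simp add: active_count_def)
  also have "\<dots> = (\<Sum>s\<in>UNIV. card ((#) s ` ?X s))"
    by (rule card_UN_disjoint) (auto intro: finite_imageI finite_length_eq)
  also have "\<dots> = (\<Sum>s\<in>UNIV. active_count nxt out n (nxt q s))"
    by (simp add: active_count_def card_image)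
  finally show ?thesis .
qed

text \<open>Trivial children have no active words below them, so leaving them out of the sum costs
  nothing; the rest is a regrouping by first letter.\<close>

lemma sum_active_count_next_level:
  "(\<Sum>q\<leftarrow>next_level nxt out S. active_count nxt out n q) = (\<Sum>q\<leftarrow>S. active_count nxt out (Suc n) q)"
proof -
  let ?c = "\<lambda>j s. active_count nxt out n (nxt (S ! j) s)"
  have "(\<Sum>q\<leftarrow>next_level nxt out S. active_count nxt out n q) =
      (\<Sum>(j, s)\<leftarrow>active_children nxt out S. ?c j s)"
    by (simp add: next_level_def o_def case_prod_unfold)
  also have "\<dots> = (\<Sum>(j, s)\<in>(SIGMA j:{..<length S}. {s. \<not> trivial_state nxt out (nxt (S ! j) s)}). ?c j s)"
    by (simp add: sum_list_distinct_conv_sum_set distinct_active_children set_active_children)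
  also have "\<dots> = (\<Sum>j<length S. \<Sum>s\<in>{s. \<not> trivial_state nxt out (nxt (S ! j) s)}. ?c j s)"
    by (rule sum.Sigma[symmetric]) auto
  also have "\<dots> = (\<Sum>j<length S. \<Sum>s\<in>UNIV. ?c j s)"
    by (intro sum.cong refl sum.mono_neutral_left) (auto simp: active_count_trivial)
  also have "\<dots> = (\<Sum>q\<leftarrow>S. active_count nxt out (Suc n) q)"
    by (simp add: active_count_Suc sum_list_sum_nth atLeast0LessThan)
  finally show ?thesis .
qed

lemma sum_active_count_funpow:
  "(\<Sum>q\<leftarrow>(next_level nxt out ^^ m) S. active_count nxt out n q) =
     (\<Sum>q\<leftarrow>S. active_count nxt out (m + n) q)"
proof (induction m arbitrary: n)
  case (Suc m)
  show ?case using Suc.IH[of "Suc n"] by (simp add: sum_active_count_next_level)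
qed simp

text \<open>Entries of a list produced by \<open>next_level\<close> are non-trivial, so each
  contributes exactly the empty word to the count at depth 0. The exponent is a successor because
  \<open>S\<close> itself may contain trivial states.\<close>

lemma length_funpow_next_level:
  "length ((next_level nxt out ^^ Suc m) S) = (\<Sum>q\<leftarrow>S. active_count nxt out (Suc m) q)"
proof -
  let ?T = "(next_level nxt out ^^ Suc m) S"
  have "\<not> trivial_state nxt out q" if q: "q \<in> set ?T" for q
    using q by (auto simp: next_level_def set_active_children)
  then have "(\<Sum>q\<leftarrow>?T. active_count nxt out 0 q) = (\<Sum>q\<leftarrow>?T. 1)"
    by (intro arg_cong[of _ _ sum_list] map_cong refl active_count_0)
  then show ?thesis
    using sum_active_count_funpow[of nxt out 0 "Suc m" S] by (simp add: sum_list_triv)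
qed

lemma set_next_level_subset:
  assumes "set S \<subseteq> Q" "\<And>q s. q \<in> Q \<Longrightarrow> nxt q s \<in> Q"
  shows "set (next_level nxt out S) \<subseteq> Q"
  using assms subsetD[OF assms(1) nth_mem] by (auto simp: next_level_def set_active_children)

lemma finite_range_next_level:
  assumes "finite Q" "set S \<subseteq> Q" "\<And>q s. q \<in> Q \<Longrightarrow> nxt q s \<in> Q"
    and bounded: "\<And>q n. q \<in> set S \<Longrightarrow> active_count nxt out n q \<le> B"
  shows "finite (range (\<lambda>n. (next_level nxt out ^^ n) S))"
proof (rule finite_subset)
  have sub: "set ((next_level nxt out ^^ n) S) \<subseteq> Q" for n
  proof (induction n)
    case (Suc n)
    then show ?case using set_next_level_subset[of _ Q nxt out] assms(3) by simp
  qed (simp add: assms(2))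
  have "length ((next_level nxt out ^^ n) S) \<le> length S + length S * B" for n
  proof (cases n)
    case (Suc m)
    have "(\<Sum>q\<leftarrow>S. active_count nxt out (Suc m) q) \<le> (\<Sum>q\<leftarrow>S. B)"
      using bounded by (intro sum_list_mono)
    then show ?thesis
      using Suc length_funpow_next_level[where nxt = nxt and out = out and m = m and S = S]
      by (simp add: sum_list_triv)
  qed simp
  with sub show "range (\<lambda>n. (next_level nxt out ^^ n) S) \<subseteq>
      {T. set T \<subseteq> Q \<and> length T \<le> length S + length S * B}"
    by auto
  show "finite {T. set T \<subseteq> Q \<and> length T \<le> length S + length S * B}"
    by (rule finite_lists_length_le[OF assms(1)])
qed

section \<open>One transducer for all generators\<close>

lemma transduce_append:
  "transduce nxt out q (x @ y) = transduce nxt out q x @ transduce nxt out (foldl nxt q x) y"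
  by (induction x arbitrary: q) auto

lemma restriction_transduce:
  "restriction (transduce nxt out q) x = transduce nxt out (foldl nxt q x)"
  by (auto simp: restriction_def transduce_append)

lemma trivial_state_iff: "trivial_state nxt out q \<longleftrightarrow> transduce nxt out q = id"
  by (auto simp: trivial_state_def)

text \<open>The disjoint union of the given transducers: a state is paired with the index of its
  generator, which selects the transition and output functions.\<close>

lemma common_transducer:
  fixes gens :: "('s::finite list \<Rightarrow> 's list) list"
  assumes gens: "\<And>a. a \<in> set gens \<Longrightarrow> automaton_automorphism a \<and> bounded_automorphism a"
  obtains nxt :: "nat \<Rightarrow> 's \<Rightarrow> nat" and out init where "length init = length gens"
    "\<And>i. i < length gens \<Longrightarrow> transduce nxt out (init ! i) = gens ! i"
    "finite (range (\<lambda>n. (next_level nxt out ^^ n) init))"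
proof -
  have "\<forall>a\<in>set gens. \<exists>Q q0 nx ou. finite (Q :: nat set) \<and> q0 \<in> Q \<and> (\<forall>q\<in>Q. \<forall>s. nx q s \<in> Q) \<and>
      a = transduce nx ou q0"
    using gens unfolding automaton_automorphism_def fun_eq_iff by blast
  then obtain Q q0 nx ou where aut: "\<And>a. a \<in> set gens \<Longrightarrow> finite (Q a :: nat set) \<and> q0 a \<in> Q a \<and>
      (\<forall>q\<in>Q a. \<forall>s. nx a q s \<in> Q a) \<and> a = transduce (nx a) (ou a) (q0 a)"
    by metis
  then have fin: "\<And>a. a \<in> set gens \<Longrightarrow> finite (Q a)" and q0: "\<And>a. a \<in> set gens \<Longrightarrow> q0 a \<in> Q a"
    and nx: "\<And>a q s. a \<in> set gens \<Longrightarrow> q \<in> Q a \<Longrightarrow> nx a q s \<in> Q a"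
    by blast+
  have eq: "transduce (nx a) (ou a) (q0 a) = a" if "a \<in> set gens" for a
    using aut[OF that] by simp
  define nxt where "nxt = (\<lambda>p s. case prod_decode p of (i, q) \<Rightarrow> prod_encode (i, nx (gens ! i) q s))"
  define out where "out = (\<lambda>p. case prod_decode p of (i, q) \<Rightarrow> ou (gens ! i) q)"
  define init where "init = map (\<lambda>i. prod_encode (i, q0 (gens ! i))) [0..<length gens]"
  define P where "P = prod_encode ` (SIGMA i:{..<length gens}. Q (gens ! i))"
  have "transduce nxt out (prod_encode (i, q)) x = transduce (nx (gens ! i)) (ou (gens ! i)) q x" for i q x
    by (induction x arbitrary: q) (auto simp: nxt_def out_def)
  then have act: "transduce nxt out (init ! i) = gens ! i" if "i < length gens" for i
    using eq[OF nth_mem[OF that]] that by (simp add: init_def fun_eq_iff)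
  have "\<forall>a\<in>set gens. \<exists>N. \<forall>k. card {x. length x = k \<and> restriction a x \<noteq> id} \<le> N"
    using gens unfolding bounded_automorphism_def by blast
  then obtain N where N: "\<And>a k. a \<in> set gens \<Longrightarrow> card {x. length x = k \<and> restriction a x \<noteq> id} \<le> N a"
    by metis
  show thesis
  proof (rule that[OF _ act])
    show "finite (range (\<lambda>n. (next_level nxt out ^^ n) init))"
    proof (rule finite_range_next_level)
      show "finite P" unfolding P_def using fin by (intro finite_imageI finite_SigmaI) auto
      show "set init \<subseteq> P" using q0 by (auto simp: P_def init_def)
      show "nxt q s \<in> P" if "q \<in> P" for q s
        using that nx by (auto simp: P_def nxt_def)
      fix q n
      assume "q \<in> set init"
      then obtain i where i: "i < length gens" "q = init ! i"
        by (auto simp: in_set_conv_nth init_def)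
      \<comment> \<open>Restrictions of a generator are the transductions from the states reached,
        so boundedness bounds this count. Summing over the generators makes the bound
        uniform.\<close>
      have "active_count nxt out n q = card {x. length x = n \<and> restriction (gens ! i) x \<noteq> id}"
        unfolding active_count_def i(2) act[OF i(1), symmetric] restriction_transduce trivial_state_iff ..
      also have "\<dots> \<le> N (gens ! i)" using N i by simp
      also have "\<dots> \<le> (\<Sum>a\<in>set gens. N a)" using i by (intro member_le_sum) auto
      finally show "active_count nxt out n q \<le> (\<Sum>a\<in>set gens. N a)" .
    qed
  qed (auto simp: init_def)
qed


section \<open>The machine\<close>

fun word_action :: "('a \<Rightarrow> 'b \<Rightarrow> 'b) \<Rightarrow> 'a list \<Rightarrow> 'b \<Rightarrow> 'b" where
  "word_action f [] x = x"
| "word_action f (a # w) x = word_action f w (f a x)"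

lemma word_action_append: "word_action f (u @ v) x = word_action f v (word_action f u x)"
  by (induction u arbitrary: x) auto

lemma run_trans: "run M C u D \<Longrightarrow> run M D v E \<Longrightarrow> run M C (u @ v) E"
  by (induction rule: run.induct) (auto intro: run.intros)

lemma run_silent_trans: "run M C [] D \<Longrightarrow> run M D v E \<Longrightarrow> run M C v E"
  using run_trans[of M C "[]" D v E] by simp

lemma step_imp_run: "step M C None D \<Longrightarrow> run M C [] D"
  by (auto intro: run.intros)

lemma symbol_at_height_nth: "n < length c \<Longrightarrow> symbol_at_height c (Suc n) = Some (c ! n)"
  by (simp add: symbol_at_height_def)

text \<open>\<open>Guess\<close> builds the check stack. \<open>Fill\<close> copies letters of
  \<open>x\<close> to the pushdown stack, either before generator \<open>i\<close> is applied or,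
  with \<open>None\<close>, after a mismatch. \<open>Down\<close> and \<open>Up\<close> carry the
  index of the current active prefix, \<open>Put\<close> also the image of the letter after which
  the restriction is trivial, and \<open>Compare\<close> the letter popped last.\<close>

datatype 's mstate = Init | Guess "nat list" | Ready | Entry | Accept
  | Fill "nat option" | Down nat | Put 's nat | Up nat | Compare "'s option"

instance mstate :: (countable) countable
  by countable_datatype

text \<open>The values fall along the phases in which one input letter is processed.\<close>

fun rank :: "'s mstate \<Rightarrow> nat" where
  "rank (Fill (Some i)) = 6"
| "rank (Down j) = 5"
| "rank (Put s j) = 4"
| "rank (Up j) = 3"
| "rank (Compare r) = 2"
| "rank (Fill None) = 1"
| "rank Ready = 1"
| "rank _ = 0"

fun ascending :: "'s mstate \<Rightarrow> bool" where
  "ascending (Fill r) = True"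
| "ascending (Up j) = True"
| "ascending _ = False"

definition letter_symbol :: "'s::finite \<Rightarrow> 'a stack_symbol" where
  "letter_symbol s = Other (to_nat s)"

text \<open>The codes of letters and of levels may coincide; the former occur only on the pushdown
  stack and the latter only on the check stack.\<close>

definition level_symbol :: "'s::finite \<Rightarrow> nat list \<Rightarrow> 'a stack_symbol" where
  "level_symbol x S = Other (to_nat (x, S))"

definition stack_symbols :: "'s::finite itself \<Rightarrow> 'a stack_symbol set" where
  "stack_symbols _ = insert Padding (range (letter_symbol :: 's \<Rightarrow> _))"

lemma letter_symbol_simps [simp]:
  "letter_symbol s = letter_symbol s' \<longleftrightarrow> s = s'"
  "letter_symbol s \<noteq> Bottom" "letter_symbol s \<noteq> Padding" "letter_symbol s \<noteq> Top"
  "Bottom \<noteq> letter_symbol s" "Padding \<noteq> letter_symbol s" "Top \<noteq> letter_symbol s"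
  by (auto simp: letter_symbol_def)

lemma level_symbol_simps [simp]:
  "level_symbol s S = level_symbol s' S' \<longleftrightarrow> s = s' \<and> S = S'"
  "level_symbol s S \<noteq> Bottom" "level_symbol s S \<noteq> Padding" "level_symbol s S \<noteq> Top"
  "Bottom \<noteq> level_symbol s S" "Padding \<noteq> level_symbol s S" "Top \<noteq> level_symbol s S"
  by (auto simp: level_symbol_def)

text \<open>The input letters are abstract; the \<open>i\<close>-th one acts by the transducer
  started at \<open>init ! i\<close>. Distinctness lets a letter determine its index.\<close>

locale transducer_machine =
  fixes nxt :: "nat \<Rightarrow> 's::finite \<Rightarrow> nat" and out :: "nat \<Rightarrow> 's \<Rightarrow> 's"
    and gens :: "'a list" and init :: "nat list"
  assumes distinct_gens: "distinct gens"
    and length_init: "length init = length gens"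
    and finite_levels: "finite (range (\<lambda>n. (next_level nxt out ^^ n) init))"
begin

abbreviation "trivial \<equiv> trivial_state nxt out"
abbreviation "children \<equiv> active_children nxt out"
abbreviation "nextl \<equiv> next_level nxt out"

definition level :: "nat \<Rightarrow> nat list" where
  "level n = (nextl ^^ n) init"

definition levels :: "nat list set" where
  "levels = range level"

text \<open>Finite because the orbit of levels is; this is how boundedness keeps the control
  finite.\<close>

definition indices :: "nat set" where
  "indices = (\<Union>S\<in>levels. {..<length S})"

lemma level_0: "level 0 = init"
  by (simp add: level_def)

lemma level_Suc: "level (Suc n) = nextl (level n)"
  by (simp add: level_def)

lemma level_in_levels [simp]: "level n \<in> levels"
  by (simp add: levels_def)

lemma init_in_levels [simp]: "init \<in> levels"
  using level_in_levels[of 0] by (simp add: level_0)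

lemma nextl_in_levels: "S \<in> levels \<Longrightarrow> nextl S \<in> levels"
  by (auto simp: levels_def simp flip: level_Suc)

lemma finite_levels': "finite levels"
  using finite_levels by (simp add: levels_def level_def)

lemma finite_indices: "finite indices"
  by (simp add: indices_def finite_levels')

lemma in_indices: "S \<in> levels \<Longrightarrow> j < length S \<Longrightarrow> j \<in> indices"
  by (auto simp: indices_def)

definition mstates :: "'s mstate set" where
  "mstates = {Init, Ready, Entry, Accept} \<union> Guess ` levels \<union> Fill ` insert None (Some ` {..<length gens})
     \<union> Down ` indices \<union> case_prod Put ` (UNIV \<times> indices) \<union> Up ` indices \<union> range Compare"

text \<open>Decodes the level of the popped prefix from the check symbol under the head. At
  \<open>Top\<close> nothing has been popped; below it the visible entry is that of the letter
  popped last and stores the level before that letter, hence \<open>nextl\<close>.\<close>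

inductive level_at :: "'a stack_symbol \<Rightarrow> nat list \<Rightarrow> bool" where
  "level_at Top init"
| "S \<in> levels \<Longrightarrow> level_at (level_symbol (x :: 's) S) (nextl S)"

text \<open>The letter popped last is the one in \<open>x\<close>; \<open>None\<close> and
  \<open>Top\<close> go together as long as nothing has been popped.\<close>

inductive agrees :: "'s option \<Rightarrow> 'a stack_symbol \<Rightarrow> bool" where
  "agrees None Top"
| "S \<in> levels \<Longrightarrow> agrees (Some x) (level_symbol x S)"

inductive check_trans :: "'s mstate \<Rightarrow> 'a stack_symbol \<Rightarrow> 's mstate \<Rightarrow> bool" where
  "S \<in> levels \<Longrightarrow> check_trans Init Bottom (Guess S)"
| "S \<in> levels \<Longrightarrow> check_trans (Guess (nextl S)) (level_symbol (x :: 's) S) (Guess S)"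
| "check_trans (Guess init) Top Ready"

text \<open>\<open>down\<close> keeps only the position \<open>k\<close> of the longer prefix, and
  \<open>up\<close> recovers parent and letter from \<open>children S ! k\<close>.
  \<open>compare_end\<close> also pops \<open>Padding\<close>, so that exactly the entry
  configuration returns.\<close>

inductive move :: "'s mstate \<Rightarrow> 'a option \<Rightarrow> 'a stack_symbol option \<Rightarrow> 'a stack_symbol option \<Rightarrow>
    'a stack_op \<Rightarrow> 's mstate \<Rightarrow> bool" where
  start: "move Ready None None None (Push Bottom) Entry"
| read_entry: "i < length gens \<Longrightarrow>
    move Entry (Some (gens ! i)) (Some Bottom) (Some Bottom) (Push Padding) (Fill (Some i))"
| read_accept: "i < length gens \<Longrightarrow> g \<in> stack_symbols TYPE('s) \<Longrightarrow>
    move Accept (Some (gens ! i)) (Some g) (Some Top) Stay (Down i)"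
| fill: "S \<in> levels \<Longrightarrow> g \<in> stack_symbols TYPE('s) \<Longrightarrow>
    move (Fill r) None (Some g) (Some (level_symbol (x :: 's) S)) (Push (letter_symbol x)) (Fill r)"
| fill_accept: "g \<in> stack_symbols TYPE('s) \<Longrightarrow> move (Fill None) None (Some g) (Some Top) Stay Accept"
| fill_down: "g \<in> stack_symbols TYPE('s) \<Longrightarrow> move (Fill (Some i)) None (Some g) (Some Top) Stay (Down i)"
| down_end: "level_at d S \<Longrightarrow> move (Down j) None (Some Padding) (Some d) Stay (Up j)"
| down: "level_at d S \<Longrightarrow> k < length (children S) \<Longrightarrow> children S ! k = (j, s) \<Longrightarrow>
    move (Down j) None (Some (letter_symbol s)) (Some d) Pop (Down k)"
| down_trivial: "level_at d S \<Longrightarrow> j < length S \<Longrightarrow> trivial (nxt (S ! j) s) \<Longrightarrow>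
    move (Down j) None (Some (letter_symbol s)) (Some d) Pop (Put (out (S ! j) s) j)"
| put: "S \<in> levels \<Longrightarrow> g \<in> stack_symbols TYPE('s) \<Longrightarrow>
    move (Put s j) None (Some g) (Some (level_symbol (x :: 's) S)) (Push (letter_symbol s)) (Up j)"
| up: "S \<in> levels \<Longrightarrow> g \<in> stack_symbols TYPE('s) \<Longrightarrow> k < length (children S) \<Longrightarrow> children S ! k = (j, s) \<Longrightarrow>
    move (Up k) None (Some g) (Some (level_symbol (x :: 's) S)) (Push (letter_symbol (out (S ! j) s))) (Up j)"
| up_end: "g \<in> stack_symbols TYPE('s) \<Longrightarrow> move (Up j) None (Some g) (Some Top) Stay (Compare None)"
| compare: "agrees r d \<Longrightarrow>
    move (Compare r) None (Some (letter_symbol s)) (Some d) Pop (Compare (Some s))"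
| compare_end: "agrees r d \<Longrightarrow> move (Compare r) None (Some Padding) (Some d) Pop Entry"
| compare_differ: "S \<in> levels \<Longrightarrow> g \<in> stack_symbols TYPE('s) \<Longrightarrow> s \<noteq> x \<Longrightarrow>
    move (Compare (Some s)) None (Some g) (Some (level_symbol (x :: 's) S)) (Push (letter_symbol s)) (Fill None)"

text \<open>\<open>move\<close> admits arbitrary indices. Restricting its source to
  \<open>mstates\<close> makes the state set finite, since by \<open>move_mstates\<close> the target
  then lies there too.\<close>

definition machine :: "(nat, 'a) cspda" where
  "machine = \<lparr>
     states = to_nat ` mstates,
     start = to_nat (Init :: 's mstate),
     accepting = {to_nat (Accept :: 's mstate)},
     check_alphabet = {Bottom, Padding, Top} \<union> case_prod level_symbol ` ((UNIV :: 's set) \<times> levels)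
       \<union> Letter ` set gens,
     pushdown_alphabet = insert Bottom (stack_symbols TYPE('s)) \<union> Letter ` set gens,
     stage1_trans = {(to_nat q, s, to_nat q') | q s q'. check_trans q s q'},
     stage2_trans = {(to_nat q, x, g, d, oper, to_nat q') | q x g d oper q'.
       q \<in> mstates \<and> move q x g d oper q'} \<rparr>"

lemma machine_simps [simp]:
  "states machine = to_nat ` mstates"
  "start machine = to_nat (Init :: 's mstate)"
  "accepting machine = {to_nat (Accept :: 's mstate)}"
  "check_alphabet machine = {Bottom, Padding, Top}
     \<union> case_prod level_symbol ` ((UNIV :: 's set) \<times> levels) \<union> Letter ` set gens"
  "pushdown_alphabet machine = insert Bottom (stack_symbols TYPE('s)) \<union> Letter ` set gens"
  "(k, s, k') \<in> stage1_trans machine \<longleftrightarrow>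
     (\<exists>q q'. k = to_nat q \<and> k' = to_nat q' \<and> check_trans q s q')"
  "(k, x, g, d, oper, k') \<in> stage2_trans machine \<longleftrightarrow>
     (\<exists>q q'. k = to_nat q \<and> k' = to_nat q' \<and> q \<in> mstates \<and> move q x g d oper q')"
  by (auto simp: machine_def)

lemma mstates_simps [simp]:
  "Init \<in> mstates" "Ready \<in> mstates" "Entry \<in> mstates" "Accept \<in> mstates"
  "Guess S \<in> mstates \<longleftrightarrow> S \<in> levels"
  "Fill None \<in> mstates" "Fill (Some i) \<in> mstates \<longleftrightarrow> i < length gens"
  "Down j \<in> mstates \<longleftrightarrow> j \<in> indices" "Put s j \<in> mstates \<longleftrightarrow> j \<in> indices"
  "Up j \<in> mstates \<longleftrightarrow> j \<in> indices" "Compare r \<in> mstates"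
  by (auto simp: mstates_def)

lemma finite_mstates: "finite mstates"
  by (simp add: mstates_def finite_levels' finite_indices)

lemma gen_in_indices: "i < length gens \<Longrightarrow> i \<in> indices"
  by (auto intro: in_indices[of init] simp: length_init)

lemma level_at_levels: "level_at d S \<Longrightarrow> S \<in> levels"
  by (auto elim!: level_at.cases intro: nextl_in_levels)

lemma level_at_unique: "level_at d S \<Longrightarrow> level_at d S' \<Longrightarrow> S = S'"
  by (auto elim!: level_at.cases)

lemma move_mstates:
  assumes "move q x g d oper q'" "q \<in> mstates"
  shows "q' \<in> mstates"
  using assms
proof (cases rule: move.cases)
  case (down d S k j s)
  then show ?thesis
    using in_indices[OF nextl_in_levels[OF level_at_levels]] by (simp add: length_next_level)
next
  case (up S g k j s x)
  then show ?thesis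
    using in_indices[OF \<open>S \<in> levels\<close>
        active_children_nth(1)[OF \<open>k < _\<close> \<open>children S ! k = _\<close>]] by simp
qed (auto simp: gen_in_indices)

lemma check_trans_mstates:
  "check_trans q s q' \<Longrightarrow> q \<in> mstates \<and> q' \<in> mstates \<and> s \<in> check_alphabet machine"
  by (auto elim!: check_trans.cases intro: nextl_in_levels)

lemma move_symbols:
  assumes "move q x g d oper q'"
  shows "set_option x \<subseteq> set gens" "set_option g \<subseteq> pushdown_alphabet machine"
    "set_option d \<subseteq> check_alphabet machine" "oper = Push s \<Longrightarrow> s \<in> pushdown_alphabet machine"
  using assms by (auto elim!: move.cases level_at.cases agrees.cases simp: stack_symbols_def)

lemma machine_cspda: "cspda_over (set gens) machine"
  unfolding cspda_over_def
proof (intro conjI)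
  show "\<forall>(q, s, q') \<in> stage1_trans machine.
      q \<in> states machine \<and> s \<in> check_alphabet machine \<and> q' \<in> states machine"
    using check_trans_mstates by fastforce
  show "\<forall>(q, x, g, d, oper, q') \<in> stage2_trans machine.
        q \<in> states machine \<and> q' \<in> states machine \<and> set_option x \<subseteq> set gens \<and>
        set_option g \<subseteq> pushdown_alphabet machine \<and> set_option d \<subseteq> check_alphabet machine \<and>
        (\<forall>s. oper = Push s \<longrightarrow> s \<in> pushdown_alphabet machine)"
  proof (clarify, unfold machine_simps(7))
    fix k x g d oper k'
    assume "\<exists>q q'. k = to_nat q \<and> k' = to_nat q' \<and> q \<in> mstates \<and> move q x g d oper q'"
    then obtain q q' where q: "k = to_nat q" "k' = to_nat q'" "q \<in> mstates" "move q x g d oper q'"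
      by blast
    from q move_mstates[OF q(4,3)] move_symbols[OF q(4)]
    show "k \<in> states machine \<and> k' \<in> states machine \<and> set_option x \<subseteq> set gens \<and>
        set_option g \<subseteq> pushdown_alphabet machine \<and> set_option d \<subseteq> check_alphabet machine \<and>
        (\<forall>s. oper = Push s \<longrightarrow> s \<in> pushdown_alphabet machine)"
      by (metis image_eqI machine_simps(1))
  qed
qed (simp_all add: finite_mstates finite_levels' stack_symbols_def)

section \<open>Reading and non-reading states\<close>

lemma Entry_reading: "reading_state machine (to_nat (Entry :: 's mstate))"
  unfolding reading_state_def by (auto elim: check_trans.cases move.cases)

lemma Accept_reading: "reading_state machine (to_nat (Accept :: 's mstate))"
  unfolding reading_state_def by (auto elim: check_trans.cases move.cases)

lemma nonreading:
  assumes "q \<in> mstates" "q \<noteq> Entry" "q \<noteq> Accept"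
  shows "nonreading_state machine (to_nat q)"
  using assms unfolding nonreading_state_def by (auto elim: move.cases)

lemma Padding_in_stack_symbols: "Padding \<in> stack_symbols TYPE('s)"
  by (simp add: stack_symbols_def)

text \<open>A state left by neither a first-stage nor a silent transition would be reading
  vacuously, and \<open>P7\<close> would force it to be an entry state or accepting.\<close>

lemma has_nonreading_move:
  assumes "q \<in> mstates" "q \<noteq> Entry" "q \<noteq> Accept"
  shows "(\<exists>s q'. check_trans q s q') \<or> (\<exists>g d oper q'. move q None g d oper q')"
proof (cases q)
  case (Guess S)
  \<comment> \<open>A level is either \<open>init\<close>, where \<open>Top\<close> may be pushed,
    or the image under \<open>nextl\<close> of the previous level, whose symbol may be
    pushed.\<close>
  then obtain n where "S = level n" using assms by (auto simp: levels_def)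
  then show ?thesis
    using Guess check_trans.intros(2)[of "level (n - 1)"] check_trans.intros(3)
    by (cases n) (auto simp: level_0 level_Suc)
next
  case (Fill r)
  then show ?thesis
    using move.fill_accept[OF Padding_in_stack_symbols] move.fill_down[OF Padding_in_stack_symbols] by (cases r) blast+
next
  case (Compare r)
  then show ?thesis
    using move.compare_end[OF agrees.intros(1)]
      move.compare_end[OF agrees.intros(2)[OF init_in_levels]]
    by (cases r) blast+
next
  case (Put s j)
  then show ?thesis
    using move.put[OF init_in_levels Padding_in_stack_symbols] by blast
next
  case (Up j)
  then show ?thesis
    using move.up_end[OF Padding_in_stack_symbols] by blast
next
  case Init
  then show ?thesis using check_trans.intros(1)[OF init_in_levels] by blast
next
  case Ready
  then show ?thesis using move.start by blast
next
  case (Down j)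
  then show ?thesis using move.down_end[OF level_at.intros(1)] by blast
qed (use assms in auto)

lemma reading_iff:
  assumes "q \<in> mstates"
  shows "reading_state machine (to_nat q) \<longleftrightarrow> q = Entry \<or> q = Accept"
proof
  assume r: "reading_state machine (to_nat q)"
  show "q = Entry \<or> q = Accept"
  proof (rule ccontr)
    assume "\<not> (q = Entry \<or> q = Accept)"
    then consider s q' where "check_trans q s q'" | g d oper q' where "move q None g d oper q'"
      using has_nonreading_move[OF assms] by blast
    then show False
    proof cases
      case 1
      then have "(to_nat q, s, to_nat q') \<in> stage1_trans machine" by auto
      with r show False unfolding reading_state_def by blast
    next
      case 2
      then have "(to_nat q, None, g, d, oper, to_nat q') \<in> stage2_trans machine"
        using assms by auto
      with r show False unfolding reading_state_def by blast
    qed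
  qed
qed (use Entry_reading Accept_reading in auto)

lemma machine_P1: "P1 machine"
proof -
  have "reading_state machine (to_nat q) \<or> nonreading_state machine (to_nat q)"
    if "q \<in> mstates" for q
    using nonreading[OF that] Entry_reading Accept_reading by blast
  then show ?thesis unfolding P1_def by simp
qed

text \<open>On the way down the check symbol fixes \<open>S\<close>; distinctness of
  \<open>children S\<close> then fixes \<open>k\<close>, and non-triviality of its entries separates
  \<open>down\<close> from \<open>down_trivial\<close>. The reading moves rely on
  \<open>distinct_gens\<close>.\<close>

lemma move_deterministic:
  assumes "move q x g d oper q'" "move q x g d oper2 q2"
  shows "oper = oper2 \<and> q' = q2"
  using assms(1)
proof (cases rule: move.cases)
  case (read_entry i)
  with assms(2) show ?thesis
    using distinct_gens by (auto elim!: move.cases simp: nth_eq_iff_index_eq)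
next
  case (read_accept i g)
  with assms(2) show ?thesis
    using distinct_gens by (auto elim!: move.cases simp: nth_eq_iff_index_eq)
next
  case (down d S k j s)
  from assms(2)[unfolded down(1-5)] show ?thesis
  proof (cases rule: move.cases)
    case (down S' k')
    then have "S' = S" using \<open>level_at d S\<close> level_at_unique by auto
    then have "k' = k"
      using down \<open>k < _\<close> \<open>children S ! k = (j, s)\<close> distinct_active_children[of nxt out S]
        nth_eq_iff_index_eq[of "children S" k' k] by simp
    with down show ?thesis using \<open>q' = _\<close> \<open>oper = _\<close> by simp
  next
    case (down_trivial S')
    then have "S' = S" using \<open>level_at d S\<close> level_at_unique by auto
    moreover have "(j, s) \<in> set (children S)" using down by (metis nth_mem)
    ultimately have False using down_trivial by (simp add: set_active_children)
    then show ?thesis ..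
  qed auto
next
  case (down_trivial d S j s)
  from assms(2)[unfolded down_trivial(1-5)] show ?thesis
  proof (cases rule: move.cases)
    case (down S' k')
    then have "S' = S" using \<open>level_at d S\<close> level_at_unique by auto
    moreover have "(j, s) \<in> set (children S')" using down nth_mem[of k' "children S'"] by simp
    ultimately have False using down_trivial by (simp add: set_active_children)
    then show ?thesis ..
  next
    case (down_trivial S')
    then have "S' = S" using \<open>level_at d S\<close> level_at_unique by auto
    with down_trivial \<open>q' = _\<close> \<open>oper = _\<close> show ?thesis by auto
  qed auto
qed (use assms(2) in \<open>auto elim!: move.cases agrees.cases simp: stack_symbols_def\<close>)

lemma machine_P2: "P2 machine"
  unfolding P2_def using move_deterministic by auto

lemma machine_P5: "P5 machine"
  unfolding P5_def using Accept_reading by simp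

lemma step_iff:
  "step machine C x D \<longleftrightarrow> (\<exists>q q' c p p' oper. C = (to_nat q, c, p) \<and> D = (to_nat q', c, p') \<and>
     q \<in> mstates \<and> move q x (top_symbol p) (symbol_at_height c (length p)) oper q' \<and>
     apply_op oper p = Some p')"
  unfolding step_def by auto

lemma stepI:
  assumes "move q x (top_symbol p) (symbol_at_height c (length p)) oper q'"
    "apply_op oper p = Some p'" "q \<in> mstates"
  shows "step machine (to_nat q, c, p) x (to_nat q', c, p')"
  using assms unfolding step_iff by blast

text \<open>
  Every silent move lowers the rank of the state or moves the head within a fixed rank in the
  one direction that \<open>ascending\<close> prescribes.
\<close>

definition potential :: "'s mstate \<times> 'a stack_symbol list \<times> 'a stack_symbol list \<Rightarrow> nat \<times> nat" where
  "potential = (\<lambda>(q, c, p).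
     (rank q, if ascending q then Suc (length c) - length p else length p))"

lemma potential_decreases:
  assumes "step machine C None D"
  shows "(potential (apfst from_nat D), potential (apfst from_nat C)) \<in> less_than <*lex*> less_than"
proof -
  obtain q q' c p p' oper where C: "C = (to_nat q, c, p)" "D = (to_nat q', c, p')"
    and t: "move q None (top_symbol p) (symbol_at_height c (length p)) oper q'"
    and p': "apply_op oper p = Some p'"
    using assms unfolding step_iff by blast
  \<comment> \<open>A visible check symbol bounds the height of the head, so the truncated
    subtraction in \<open>potential\<close> really drops at each push.\<close>
  have p: "symbol_at_height c (length p) \<noteq> None \<Longrightarrow> length p \<le> length c"
    unfolding symbol_at_height_def by (auto split: if_splits)
  have pop: "oper = Pop \<Longrightarrow> length p' < length p" using p' by (cases p) auto
  show ?thesis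
    using t p' p pop unfolding C potential_def by cases auto
qed

text \<open>Well-foundedness excludes infinite silent sequences from every configuration, reachable
  or not.\<close>

lemma machine_P4: "P4 machine"
proof -
  have "wf (inv_image (less_than <*lex*> less_than)
      (\<lambda>C. potential (apfst from_nat C :: 's mstate \<times> 'a stack_symbol list \<times> 'a stack_symbol list)))"
    by auto
  then have "\<not> (\<exists>f. \<forall>i::nat. step machine (f i) None (f (Suc i)))"
    unfolding wf_iff_no_infinite_down_chain using potential_decreases
    by (meson in_inv_image)
  then show ?thesis unfolding P4_def by blast
qed

text \<open>
  The symbol for \<open>x ! i\<close> carries the level before this letter. The \<open>Padding\<close> above the bottom of the
  pushdown stack shifts the letters up by one, so that the check symbol under the head
  describes the letter to be pushed next, and \<open>Top\<close> is seen when the whole string is on the stack.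
\<close>

definition check_stack :: "nat list \<Rightarrow> 's list \<Rightarrow> 'a stack_symbol list" where
  "check_stack S x = rev (map (\<lambda>i. level_symbol (x ! i) ((nextl ^^ i) S)) [0..<length x])"

lemma check_stack_Cons: "check_stack S (a # x) = check_stack (nextl S) x @ [level_symbol a S]"
  unfolding check_stack_def
  by (simp add: upt_conv_Cons map_Suc_upt[symmetric] funpow_swap1 o_def del: upt_Suc)

definition full_check :: "'s list \<Rightarrow> 'a stack_symbol list" where
  "full_check x = Bottom # check_stack init x @ [Top]"

text \<open>The level at the end of the string is guessed first, and each further symbol steps back
  along \<open>nextl\<close>. Since \<open>Top\<close> can be pushed only at \<open>init\<close>,
  the entries of a finished stack, read from the top, form the orbit of \<open>init\<close>.\<close>

lemma stage1_cases:
  assumes "stage1 machine k c"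
  shows "(k = to_nat (Init :: 's mstate) \<and> c = []) \<or>
    (\<exists>S x. k = to_nat (Guess S :: 's mstate) \<and> c = Bottom # check_stack S x) \<or>
    (\<exists>x. k = to_nat (Ready :: 's mstate) \<and> c = full_check x)"
  using assms
proof induction
  case stage1_start
  then show ?case by simp
next
  case (stage1_push k c s k')
  then obtain q q' where q: "k = to_nat q" "k' = to_nat q'" "check_trans q s q'" by auto
  from q(3) show ?case
  proof cases
    case (1 S)
    then have "c @ [s] = Bottom # check_stack S []"
      using stage1_push.IH q by (auto simp: check_stack_def)
    with 1 q show ?thesis by blast
  next
    case (2 S a)
    then obtain x where "c = Bottom # check_stack (nextl S) x"
      using stage1_push.IH q by auto
    then have "c @ [s] = Bottom # check_stack S (a # x)"
      using 2 by (simp add: check_stack_Cons)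
    with 2 q show ?thesis by blast
  next
    case 3
    then obtain x where "c = Bottom # check_stack init x"
      using stage1_push.IH q by auto
    then have "c @ [s] = full_check x" using 3 by (simp add: full_check_def)
    with 3 q show ?thesis by blast
  qed
qed

text \<open>The last letter is pushed first, so the tail is built one level deeper; hence the
  induction varies \<open>n\<close>.\<close>

lemma stage1_guess: "stage1 machine (to_nat (Guess (level n) :: 's mstate)) (Bottom # check_stack (level n) x)"
proof (induction x arbitrary: n)
  case Nil
  have "stage1 machine (to_nat (Guess (level n) :: 's mstate)) ([] @ [Bottom])"
    by (rule stage1_push[OF stage1_start]) (auto intro: check_trans.intros)
  then show ?case by (simp add: check_stack_def)
next
  case (Cons a x)
  have "stage1 machine (to_nat (Guess (level n) :: 's mstate))
      ((Bottom # check_stack (level (Suc n)) x) @ [level_symbol a (level n)])"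
    by (rule stage1_push[OF Cons.IH]) (auto intro: check_trans.intros simp: level_Suc)
  then show ?case by (simp add: check_stack_Cons level_Suc)
qed

lemma stage1_ready: "stage1 machine (to_nat (Ready :: 's mstate)) (full_check x)"
proof -
  have "stage1 machine (to_nat (Ready :: 's mstate)) ((Bottom # check_stack init x) @ [Top])"
    by (rule stage1_push[OF stage1_guess[of 0, unfolded level_0]]) (auto intro: check_trans.intros)
  then show ?thesis by (simp add: full_check_def)
qed

section \<open>Entry configurations\<close>

lemma first_step:
  assumes "stage1 machine k c" "step machine (k, c, []) x D"
  obtains y where "k = to_nat (Ready :: 's mstate)" "c = full_check y"
    "D = (to_nat (Entry :: 's mstate), full_check y, [Bottom])"
proof -
  obtain q q' p' oper where D: "k = to_nat q" "D = (to_nat q', c, p')"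
    "move q x None None oper q'" "apply_op oper [] = Some p'"
    using assms(2) unfolding step_iff by (auto simp: top_symbol_def symbol_at_height_def)
  from D(3) have "q = Ready" "oper = Push Bottom" "q' = Entry" by (auto elim: move.cases)
  then show thesis using D that stage1_cases[OF assms(1)] by auto
qed

lemma entry_step:
  "step machine (to_nat (Ready :: 's mstate), full_check x, []) None
     (to_nat (Entry :: 's mstate), full_check x, [Bottom])"
  by (rule stepI[where oper = "Push Bottom"])
    (auto intro: move.start simp: top_symbol_def symbol_at_height_def)

lemma entry_config_iff:
  "entry_config machine C \<longleftrightarrow> (\<exists>x. C = (to_nat (Entry :: 's mstate), full_check x, [Bottom]))"
  unfolding entry_config_def using stage1_ready entry_step by (blast elim: first_step)

lemma machine_P7: "P7 machine"
proof -
  have "entry_state machine k \<longleftrightarrow> k = to_nat (Entry :: 's mstate)" for k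
    unfolding entry_state_def entry_config_iff by auto
  then show ?thesis
    unfolding P7_def using reading_iff by auto
qed

lemma set_check_stack: "Bottom \<notin> set (check_stack S x)" "Top \<notin> set (check_stack S x)"
  by (auto simp: check_stack_def)

lemma machine_P3: "P3 machine"
  unfolding P3_def
proof (intro conjI allI impI)
  fix k c x D
  assume "stage1 machine k c" "step machine (k, c, []) x D"
  then show "\<exists>c'. c = Bottom # c' @ [Top] \<and> Bottom \<notin> set c' \<and> Top \<notin> set c'"
    by (auto elim!: first_step simp: full_check_def set_check_stack)
next
  show "\<forall>(q, x, g, d, oper, q') \<in> stage2_trans machine.
        (g = None \<longrightarrow> x = None \<and> oper = Push Bottom \<and> reading_state machine q') \<and>
        (g \<noteq> None \<longrightarrow> oper \<noteq> Push Bottom) \<and>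
        oper \<noteq> Push Top \<and>
        (g = Some Bottom \<longrightarrow> oper \<noteq> Pop) \<and>
        (d = Some Top \<longrightarrow> (\<forall>s. oper \<noteq> Push s))"
    by (clarify, unfold machine_simps(7))
      (auto elim!: move.cases simp: Entry_reading stack_symbols_def)
qed (simp_all add: stack_symbols_def)


section \<open>Simulating the action on a string\<close>

definition stack :: "'s list \<Rightarrow> 'a stack_symbol list" where
  "stack y = map letter_symbol y @ [Padding, Bottom]"

lemma stack_Nil: "stack [] = [Padding, Bottom]"
  and stack_Cons: "stack (s # y) = letter_symbol s # stack y"
  by (simp_all add: stack_def)

lemma top_stack: "\<exists>g \<in> stack_symbols TYPE('s). top_symbol (stack y) = Some g"
  by (cases y) (auto simp: stack_def top_symbol_def stack_symbols_def)

text \<open>With the first \<open>n\<close> letters missing from the pushdown stack, the head sees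
  the entry of the last missing one. The same entry thus serves the letter popped last and the
  letter to be pushed next.\<close>

lemma check_symbol_stack:
  assumes "n + length z = length x"
  shows "symbol_at_height (full_check x) (length (stack z)) =
    Some (if n = 0 then Top else level_symbol (x ! (n - 1)) (level (n - 1)))"
proof -
  have "symbol_at_height (full_check x) (length (stack z)) = Some (full_check x ! Suc (length z))"
    using assms symbol_at_height_nth[of "Suc (length z)" "full_check x"]
    by (simp add: full_check_def check_stack_def stack_def)
  also have "full_check x ! Suc (length z) = (check_stack init x @ [Top]) ! length z"
    by (simp add: full_check_def)
  also have "\<dots> = (if n = 0 then Top else level_symbol (x ! (n - 1)) (level (n - 1)))"
    using assms by (auto simp: check_stack_def level_def nth_append rev_nth)
      (auto simp flip: assms)
  finally show ?thesis .
qed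

lemmas check_symbol_stack_0 = check_symbol_stack[where n = 0, simplified]
lemmas check_symbol_stack_Suc = check_symbol_stack[where n = "Suc n" for n, simplified]

abbreviation cfg :: "'s mstate \<Rightarrow> 's list \<Rightarrow> 'a stack_symbol list \<Rightarrow> (nat, 'a) config" where
  "cfg q x p \<equiv> (to_nat q, full_check x, p)"

lemma run_fill:
  assumes "n + length z = length x" "Fill r \<in> mstates"
  shows "run machine (cfg (Fill r) x (stack z)) [] (cfg (Fill r) x (stack (take n x @ z)))"
  using assms(1)
proof (induction n arbitrary: z)
  case 0
  then show ?case by (simp add: run_refl)
next
  case (Suc n)
  obtain g where g: "g \<in> stack_symbols TYPE('s)" "top_symbol (stack z) = Some g" using top_stack by blast
  have "step machine (cfg (Fill r) x (stack z)) None (cfg (Fill r) x (stack (x ! n # z)))"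
    using Suc.prems g assms(2)
    by (intro stepI[where oper = "Push (letter_symbol (x ! n))"])
      (auto intro: move.fill simp: check_symbol_stack_Suc stack_Cons)
  moreover have "run machine (cfg (Fill r) x (stack (x ! n # z))) []
      (cfg (Fill r) x (stack (take n x @ x ! n # z)))"
    using Suc.prems by (intro Suc.IH) simp
  ultimately have "run machine (cfg (Fill r) x (stack z)) [] (cfg (Fill r) x (stack (take n x @ x ! n # z)))"
    by (rule run_silent)
  then show ?case using Suc.prems by (simp add: take_Suc_conv_app_nth)
qed

lemma level_at_check:
  assumes "n + length z = length x"
  shows "\<exists>d. symbol_at_height (full_check x) (length (stack z)) = Some d \<and> level_at d (level n)"
  using check_symbol_stack[OF assms] level_at.intros
  by (cases n) (auto simp: level_0 level_Suc)

text \<open>The moves \<open>Down\<close> and \<open>Up\<close> at one letter enclose the run on the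
  rest of the string. No memory of the popped letters is needed: on return, index and check symbol
  restore the situation before the pop.\<close>

lemma run_down_up:
  assumes "n + length z = length x" "j < length (level n)"
  shows "run machine (cfg (Down j) x (stack z)) []
     (cfg (Up j) x (stack (transduce nxt out (level n ! j) z)))"
  using assms
proof (induction z arbitrary: n j)
  case Nil
  then have "j \<in> indices" using in_indices[OF level_in_levels] by blast
  with Nil level_at_check[of n "[]" x] show ?case
    by (auto intro!: step_imp_run stepI[where oper = Stay] intro: move.intros
        simp: stack_Nil top_symbol_def)
next
  case (Cons s z)
  let ?q = "level n ! j"
  have j: "j \<in> indices" using Cons.prems in_indices[OF level_in_levels] by blast
  have len: "Suc n + length z = length x" using Cons.prems by simp
  obtain d where d: "symbol_at_height (full_check x) (length (stack (s # z))) = Some d"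
    "level_at d (level n)"
    using level_at_check Cons.prems(1) by blast
  have top: "top_symbol (stack (s # z)) = Some (letter_symbol s)"
    by (simp add: stack_Cons top_symbol_def)
  let ?y = "transduce nxt out (nxt ?q s) z"
  obtain g where g: "g \<in> stack_symbols TYPE('s)" "top_symbol (stack ?y) = Some g" using top_stack by blast
  \<comment> \<open>Once \<open>s\<close> is off the stack, the visible entry is that of letter
    \<open>n\<close>, which stores \<open>level n\<close>.\<close>
  have sym: "symbol_at_height (full_check x) (length (stack y)) =
      Some (level_symbol (x ! n) (level n))" if "length y = length z" for y
    using check_symbol_stack[of "Suc n" y x] len that by simp
  have goal_eq: "transduce nxt out ?q (s # z) = out ?q s # ?y" by simp
  show ?case
  proof (cases "trivial (nxt ?q s)")
    case False
    then obtain k where k: "k < length (children (level n))" "children (level n) ! k = (j, s)"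
      using active_childrenE Cons.prems(2) by blast
    then have k': "k < length (level (Suc n))" "level (Suc n) ! k = nxt ?q s"
      using active_children_nth(2) by (auto simp: level_Suc length_next_level)
    have "step machine (cfg (Down j) x (stack (s # z))) None (cfg (Down k) x (stack z))"
      using d top k j
      by (intro stepI[where oper = Pop]) (auto intro: move.down simp: stack_Cons)
    moreover have "run machine (cfg (Down k) x (stack z)) [] (cfg (Up k) x (stack ?y))"
      using Cons.IH[OF len k'(1)] k'(2) by simp
    \<comment> \<open>Here \<open>k\<close> and the stored \<open>level n\<close> give back
      \<open>j\<close> together with the lost letter \<open>s\<close>.\<close>
    moreover have "step machine (cfg (Up k) x (stack ?y)) None (cfg (Up j) x (stack (out ?q s # ?y)))"
      using k k' g in_indices[OF level_in_levels k'(1)]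
      by (intro stepI[where oper = "Push (letter_symbol (out ?q s))"])
        (auto intro: move.up simp: sym stack_Cons)
    ultimately show ?thesis unfolding goal_eq
      by (meson run_silent run_silent_trans step_imp_run)
  next
    case True
    \<comment> \<open>A trivial restriction fixes the rest of the string, so the descent can stop
      here.\<close>
    have y: "?y = z" using True by (simp add: trivial_state_def)
    have "step machine (cfg (Down j) x (stack (s # z))) None (cfg (Put (out ?q s) j) x (stack z))"
      using d top True j Cons.prems(2)
      by (intro stepI[where oper = Pop]) (auto intro: move.down_trivial simp: stack_Cons)
    moreover have "step machine (cfg (Put (out ?q s) j) x (stack z)) None
        (cfg (Up j) x (stack (out ?q s # z)))"
      using g j
      by (intro stepI[where oper = "Push (letter_symbol (out ?q s))"])
        (auto intro: move.put simp: sym stack_Cons y)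
    ultimately show ?thesis unfolding goal_eq y
      by (meson run_silent step_imp_run)
  qed
qed

definition config_of :: "'s list \<Rightarrow> 's list \<Rightarrow> (nat, 'a) config" where
  "config_of x y = (if y = x then cfg Entry x [Bottom] else cfg Accept x (stack y))"

lemma reading_config_of: "reading_config machine (config_of x y)"
  unfolding reading_config_def config_of_def using Entry_reading Accept_reading by simp

text \<open>The popped letters agree with \<open>x\<close>, so after a mismatch
  \<open>Fill None\<close> can restore them from the check stack. Without a mismatch the string is
  \<open>x\<close> and the stack ends up emptied.\<close>

lemma run_compare:
  assumes "n + length z = length x" "n = 0 \<longleftrightarrow> r = None" "n > 0 \<Longrightarrow> r = Some (x ! (n - 1))"
  shows "run machine (cfg (Compare r) x (stack z)) [] (config_of x (take n x @ z))"
  using assms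
proof (induction z arbitrary: n r)
  case Nil
  have d: "\<exists>d. symbol_at_height (full_check x) (length (stack [])) = Some d \<and> agrees r d"
    using check_symbol_stack[OF Nil.prems(1)] agrees.intros Nil.prems by auto
  then show ?case
    using Nil
    by (auto intro!: step_imp_run stepI[where oper = Pop] intro: move.intros
        simp: stack_Nil top_symbol_def config_of_def)
next
  case (Cons s z)
  have len: "Suc n + length z = length x" using Cons.prems by simp
  have "\<exists>d. symbol_at_height (full_check x) (length (stack (s # z))) = Some d \<and> agrees r d"
    using check_symbol_stack[OF Cons.prems(1)] agrees.intros Cons.prems by auto
  \<comment> \<open>This move tests the letter popped before \<open>s\<close>; its pop brings the
    entry for \<open>s\<close> itself under the head, to be tested next.\<close>
  then have s1: "step machine (cfg (Compare r) x (stack (s # z))) None (cfg (Compare (Some s)) x (stack z))"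
    by (auto intro!: stepI[where oper = Pop] intro: move.compare simp: stack_Cons top_symbol_def)
  have take: "take (Suc n) x = take n x @ [x ! n]"
    using Cons.prems by (simp add: take_Suc_conv_app_nth)
  show ?case
  proof (cases "s = x ! n")
    case True
    have "run machine (cfg (Compare (Some s)) x (stack z)) [] (config_of x (take (Suc n) x @ z))"
      by (rule Cons.IH[OF len]) (auto simp: True)
    from run_silent[OF s1 this] show ?thesis by (simp add: True take)
  next
    case False
    obtain g where g: "g \<in> stack_symbols TYPE('s)" "top_symbol (stack z) = Some g" using top_stack by blast
    have s2: "step machine (cfg (Compare (Some s)) x (stack z)) None (cfg (Fill None) x (stack (s # z)))"
      using g False
      by (intro stepI[where oper = "Push (letter_symbol s)"])
        (auto intro: move.compare_differ simp: check_symbol_stack_Suc[OF len[simplified]] stack_Cons)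
    let ?y = "take n x @ s # z"
    have s3: "run machine (cfg (Fill None) x (stack (s # z))) [] (cfg (Fill None) x (stack ?y))"
      using Cons.prems by (intro run_fill) auto
    obtain g' where g': "g' \<in> stack_symbols TYPE('s)" "top_symbol (stack ?y) = Some g'" using top_stack by blast
    have leny: "length ?y = length x" using Cons.prems by simp
    have s4: "step machine (cfg (Fill None) x (stack ?y)) None (cfg Accept x (stack ?y))"
      using g'
      by (intro stepI[where oper = Stay])
        (auto intro: move.fill_accept simp: check_symbol_stack_0[OF leny])
    have "?y ! n = s" using Cons.prems by (simp add: nth_append)
    then have "?y \<noteq> x" using False by auto
    then have "config_of x ?y = cfg Accept x (stack ?y)" by (simp add: config_of_def)
    with run_silent[OF s1 run_silent[OF s2 run_silent_trans[OF s3 step_imp_run[OF s4]]]]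
    show ?thesis by simp
  qed
qed

definition letter_action :: "'a \<Rightarrow> 's list \<Rightarrow> 's list" where
  "letter_action a = transduce nxt out (init ! (THE i. i < length gens \<and> gens ! i = a))"

lemma letter_action_nth:
  assumes "i < length gens"
  shows "letter_action (gens ! i) = transduce nxt out (init ! i)"
proof -
  have "(THE k. k < length gens \<and> gens ! k = gens ! i) = i"
    using assms distinct_gens by (auto simp: nth_eq_iff_index_eq)
  then show ?thesis by (simp add: letter_action_def)
qed

lemma length_letter_action [simp]: "length (letter_action a x) = length x"
  by (simp add: letter_action_def)

text \<open>An emptied stack stands for \<open>x\<close> and is first refilled; from
  \<open>Down i\<close> on both cases run alike.\<close>

lemma run_letter:
  assumes "a \<in> set gens" "length y = length x"
  shows "run machine (config_of x y) [a] (config_of x (letter_action a y))"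
proof -
  obtain i where i: "i < length gens" "a = gens ! i" using assms by (auto simp: in_set_conv_nth)
  let ?z = "letter_action a y"
  have 1: "run machine (config_of x y) [a] (cfg (Down i) x (stack y))"
  proof (cases "y = x")
    case True
    have "step machine (cfg Entry x [Bottom]) (Some a) (cfg (Fill (Some i)) x (stack []))"
      using i
      by (intro stepI[where oper = "Push Padding"])
        (auto intro: move.read_entry simp: top_symbol_def symbol_at_height_def full_check_def stack_Nil)
    moreover have "run machine (cfg (Fill (Some i)) x (stack [])) [] (cfg (Fill (Some i)) x (stack x))"
      using run_fill[of "length x" "[]" x "Some i"] i by simp
    moreover obtain g where g: "g \<in> stack_symbols TYPE('s)" "top_symbol (stack x) = Some g"
      using top_stack by blast
    then have "step machine (cfg (Fill (Some i)) x (stack x)) None (cfg (Down i) x (stack x))"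
      using i
      by (intro stepI[where oper = Stay]) (auto intro: move.fill_down simp: check_symbol_stack_0)
    ultimately show ?thesis
      using True unfolding config_of_def by (auto intro: run_read run_silent_trans step_imp_run)
  next
    case False
    obtain g where g: "g \<in> stack_symbols TYPE('s)" "top_symbol (stack y) = Some g" using top_stack by blast
    have "step machine (cfg Accept x (stack y)) (Some a) (cfg (Down i) x (stack y))"
      using i g assms(2)
      by (intro stepI[where oper = Stay]) (auto intro: move.read_accept simp: check_symbol_stack_0)
    then show ?thesis
      using False unfolding config_of_def by (auto intro: run_read run_refl)
  qed
  have 2: "run machine (cfg (Down i) x (stack y)) [] (cfg (Up i) x (stack ?z))"
    \<comment> \<open>At level 0 the list is \<open>init\<close>, so the number of the generator is
      itself the first index.\<close>
    using run_down_up[of 0 y x i] i assms(2) by (simp add: level_0 length_init letter_action_nth)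
  obtain g where g: "g \<in> stack_symbols TYPE('s)" "top_symbol (stack ?z) = Some g" using top_stack by blast
  have 3: "step machine (cfg (Up i) x (stack ?z)) None (cfg (Compare None) x (stack ?z))"
    using i g assms(2) gen_in_indices
    by (intro stepI[where oper = Stay]) (auto intro: move.up_end simp: check_symbol_stack_0)
  have 4: "run machine (cfg (Compare None) x (stack ?z)) [] (config_of x ?z)"
    using run_compare[of 0 ?z x None] assms(2) by simp
  show ?thesis
    using run_trans[OF 1 run_silent_trans[OF 2 run_silent[OF 3 4]]] by simp
qed

abbreviation "wact \<equiv> word_action letter_action"

lemma run_word:
  assumes "w \<in> lists (set gens)" "length y = length x"
  shows "run machine (config_of x y) w (config_of x (wact w y))"
  using assms
proof (induction w arbitrary: y)
  case Nil
  then show ?case by (simp add: run_refl)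
next
  case (Cons a w)
  have "run machine (config_of x y) ([a] @ w) (config_of x (wact w (letter_action a y)))"
    using Cons by (intro run_trans[OF run_letter Cons.IH]) auto
  then show ?case by simp
qed

lemma config_of_self: "config_of x x = cfg Entry x [Bottom]"
  by (simp add: config_of_def)

section \<open>Uniqueness of runs\<close>

lemma step_deterministic:
  assumes "step machine C x D" "step machine C x D'"
  shows "D = D'"
proof -
  obtain q c p oper q' p' where 1: "C = (to_nat q, c, p)" "D = (to_nat q', c, p')"
    "move q x (top_symbol p) (symbol_at_height c (length p)) oper q'" "apply_op oper p = Some p'"
    using assms(1) unfolding step_iff by blast
  obtain oper2 q2 p2 where 2: "D' = (to_nat q2, c, p2)"
    "move q x (top_symbol p) (symbol_at_height c (length p)) oper2 q2" "apply_op oper2 p = Some p2"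
    using assms(2) 1(1) unfolding step_iff by auto
  show ?thesis
    using move_deterministic[OF 1(3) 2(2)] 1 2 by simp
qed

lemma reading_no_silent: "reading_config machine C \<Longrightarrow> \<not> step machine C None D"
  unfolding reading_config_def reading_state_def step_def by (metis fst_conv)

lemma silent_no_read:
  assumes "step machine C None D"
  shows "\<not> step machine C (Some a) E"
proof
  assume "step machine C (Some a) E"
  with assms obtain k g d oper k' g' d' oper' k''
    where t: "(k, None, g, d, oper, k') \<in> stage2_trans machine"
      "(k, Some a, g', d', oper', k'') \<in> stage2_trans machine"
    unfolding step_def by blast
  then have "k \<in> states machine" by auto
  with t show False
    using machine_P1 unfolding P1_def reading_state_def nonreading_state_def by blast
qed

text \<open>Steps are unique, and a reading configuration has no silent step, so neither run can go
  on silently where the other one stops.\<close>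

lemma run_deterministic:
  assumes "run machine C w D" "run machine C w D'" "reading_config machine D" "reading_config machine D'"
  shows "D = D'"
  using assms
proof (induction rule: run.induct)
  case (run_refl C)
  then show ?case using reading_no_silent by (cases rule: run.cases) auto
next
  case (run_silent C C' w D)
  note hyp = run_silent.IH and prems = run_silent.prems
  from run_silent.prems(1) show ?case
  proof (cases rule: run.cases)
    case run_refl
    then show ?thesis using reading_no_silent run_silent by blast
  next
    case (run_silent C'')
    have "C'' = C'"
      using step_deterministic[OF \<open>step machine C None C''\<close> \<open>step machine C None C'\<close>] .
    with local.run_silent(2) show ?thesis using hyp prems by blast
  next
    case (run_read a C'' w')
    then show ?thesis using silent_no_read \<open>step machine C None C'\<close> by blast
  qed
next
  case (run_read C a C' w D)
  note hyp = run_read.IH and prems = run_read.prems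
  from run_read.prems(1) show ?case
  proof (cases rule: run.cases)
    case (run_silent C'')
    then show ?thesis using silent_no_read \<open>step machine C (Some a) C'\<close> by blast
  next
    case (run_read C'')
    have "C'' = C'"
      using step_deterministic[OF \<open>step machine C (Some a) C''\<close> \<open>step machine C (Some a) C'\<close>] .
    with local.run_read(2) show ?thesis using hyp prems by blast
  qed
qed

section \<open>The accepted language and \<open>P6\<close>\<close>

lemma language_machine: "language (set gens) machine = {w \<in> lists (set gens). \<exists>x. wact w x \<noteq> x}"
proof (intro Set.set_eqI iffI)
  fix w
  assume "w \<in> language (set gens) machine"
  then obtain k c C where w: "w \<in> lists (set gens)" and s: "stage1 machine k c"
    and r: "run machine (k, c, []) w C" and a: "fst C = to_nat (Accept :: 's mstate)"
    unfolding language_def accepting_config_def by auto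
  \<comment> \<open>First-stage states do not accept, so the run contains a first second-stage step,
    which must start in \<open>Ready\<close>.\<close>
  have "(k, c, []) \<noteq> C" using stage1_cases[OF s] a by auto
  with r obtain x D where "step machine (k, c, []) x D"
    by (cases rule: run.cases) auto
  then obtain y where y: "k = to_nat (Ready :: 's mstate)" "c = full_check y"
    using first_step[OF s] by metis
  have "run machine (k, c, []) w (config_of y (wact w y))"
    using run_silent[OF entry_step] run_word[OF w refl] y by (simp add: config_of_self)
  moreover have "reading_config machine C" using a Accept_reading by (simp add: reading_config_def)
  \<comment> \<open>The given accepting run has to coincide with the simulated one.\<close>
  ultimately have "C = config_of y (wact w y)"
    using run_deterministic[OF r] reading_config_of by blast
  with a have "wact w y \<noteq> y" by (auto simp: config_of_def)
  with w show "w \<in> {w \<in> lists (set gens). \<exists>x. wact w x \<noteq> x}" by blast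
next
  fix w
  assume "w \<in> {w \<in> lists (set gens). \<exists>x. wact w x \<noteq> x}"
  then obtain x where w: "w \<in> lists (set gens)" and x: "wact w x \<noteq> x" by blast
  have "run machine (cfg Ready x []) w (config_of x (wact w x))"
    using run_silent[OF entry_step] run_word[OF w refl] by (simp add: config_of_self)
  moreover have "accepting_config machine (config_of x (wact w x))"
    using x by (simp add: accepting_config_def config_of_def)
  ultimately show "w \<in> language (set gens) machine"
    unfolding language_def using w stage1_ready by blast
qed

text \<open>A word \<open>v\<close> outside the language fixes every string, so \<open>u @ v\<close>
  and \<open>u\<close> have the same image of \<open>x\<close>, and that image determines the
  configuration.\<close>

lemma machine_P6: "P6 (set gens) machine"
  unfolding P6_def
proof (intro allI ballI impI disjI1)
  fix C u v
  assume u: "u \<in> lists (set gens)" and v: "v \<in> lists (set gens)"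
    and C: "entry_config machine C" and vL: "v \<notin> language (set gens) machine"
  obtain x where x: "C = config_of x x" using C by (auto simp: entry_config_iff config_of_self)
  have "wact v y = y" for y using v vL by (auto simp: language_machine)
  then have eq: "wact (u @ v) x = wact u x" by (simp add: word_action_append)
  have "run machine C (u @ v) (config_of x (wact u x))"
    using run_word[of "u @ v" x x] u v eq x by simp
  then show "\<exists>D. result machine C (u @ v) D \<and> result machine C u D"
    unfolding result_def using run_word[OF u refl, of x] x reading_config_of by blast
qed

theorem special_machine: "special_cspda (set gens) machine"
  unfolding special_cspda_def
  using machine_cspda machine_P1 machine_P2 machine_P3 machine_P4 machine_P5 machine_P6 machine_P7
  by blast

end


section \<open>From the group to the machine\<close>

theorem theorem4p1:
  fixes G :: "('s::finite list \<Rightarrow> 's list) monoid"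
  assumes "bounded_automata_group G" and "finitely_generated_group G"
  shows "special_co_ET0L_group G"
proof -
  obtain H where H: "subgroup H bounded_automaton_aut_group"
    and G: "G = bounded_automaton_aut_group \<lparr> carrier := H \<rparr>"
    using assms(1) unfolding bounded_automata_group_def by blast
  have elements: "automaton_automorphism a \<and> bounded_automorphism a" if "a \<in> carrier G" for a
    using that subgroup.subset[OF H] by (auto simp: G bounded_automaton_aut_group_def)
  have mult: "a \<otimes>\<^bsub>G\<^esub> b = b \<circ> a" and one: "\<one>\<^bsub>G\<^esub> = id" for a b
    by (simp_all add: G bounded_automaton_aut_group_def)
  obtain A0 where A0: "finite A0" "A0 \<subseteq> carrier G" "generate G A0 = carrier G" and "group G"
    using assms(2) unfolding finitely_generated_group_def by blast
  interpret group G by fact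
  \<comment> \<open>Adding the inverses gives an inverse-closed set that still generates
    \<open>G\<close>.\<close>
  define A where "A = A0 \<union> m_inv G ` A0"
  have A: "finite A" "A \<subseteq> carrier G" "\<forall>a\<in>A. inv\<^bsub>G\<^esub> a \<in> A"
    using A0 by (auto simp: A_def)
  have "carrier G \<subseteq> generate G A"
    using mono_generate[of A0 A] A0(3) by (simp add: A_def)
  then have gen: "generate G A = carrier G" using generate_incl[OF A(2)] by blast
  obtain gens where gens: "set gens = A" "distinct gens"
    using finite_distinct_list[OF A(1)] by blast
  have "automaton_automorphism a \<and> bounded_automorphism a" if "a \<in> set gens" for a
    using that elements A(2) gens(1) by blast
  then obtain nxt out init where t: "length init = length gens"
    "\<And>i. i < length gens \<Longrightarrow> transduce nxt out (init ! i) = gens ! i"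
    "finite (range (\<lambda>n. (next_level nxt out ^^ n) init))"
    by (rule common_transducer[of gens]) (assumption | rule that)+
  interpret M: transducer_machine nxt out gens init
    using gens(2) t by unfold_locales auto
  have letter: "M.letter_action a = a" if "a \<in> A" for a
    using that t(2) by (auto simp: gens(1)[symmetric] in_set_conv_nth M.letter_action_nth)
  have word: "word_value G w x = word_action M.letter_action w x" if "w \<in> lists A" for w x
    using that
  proof (induction w arbitrary: x)
    case Nil
    then show ?case by (simp add: word_value_def one)
  next
    case (Cons a w)
    \<comment> \<open>The product applies its left factor first, so the first letter acts first, as
      in \<open>word_action\<close>.\<close>
    have "word_value G (a # w) x = word_value G w (a x)" by (simp add: word_value_def mult)
    with Cons show ?case by (simp add: letter)
  qed
  \<comment> \<open>An element differs from \<open>id\<close> exactly when it moves some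
    string.\<close>
  have "language A M.machine = coWP G A"
    using M.language_machine by (simp add: gens(1) coWP_def one fun_eq_iff word cong: conj_cong)
  moreover have "Letter ` A \<subseteq> check_alphabet M.machine" "Letter ` A \<subseteq> pushdown_alphabet M.machine"
    by (auto simp: gens(1))
  moreover have "special_cspda A M.machine" using M.special_machine by (simp add: gens(1))
  ultimately show ?thesis
    unfolding special_co_ET0L_group_def using assms(2) A gen by blast
qed

end
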